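(* Let $F_m(x)=\sum_{n\ge0}b(n,m)x^n$ for $m\ge0$. Then $F_0(x)=\frac{1}{1-x}$ and, for every integer $m\ge1$, $$F_m(x)=\frac{1}{-x+F_{m-1}(-x)}.$$
   Context: For a positive integer $m$, $B(m)=(b_{ij})_{1\le i,j\le m}$ is the $m\times m$ matrix with $b_{ij}=1$ if $i+j\le m+1$ and $0$ otherwise. For a square matrix $A$, $s(A)$ is the sum of all its entries. Define $b(n,m)$ for $n,m\ge0$ by $b(n,m)=1$ if $n=0$ or $m=0$, and $b(n,m)=s\big(B(m+1)^{n-1}\big)$ if $n,m\ge1$. The identities are of formal power series (equivalently rational functions) in $x$. *)

theory Defs
  imports
    "HOL-Computational_Algebra.Formal_Power_Series"
    "Jordan_Normal_Form.Matrix"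
begin

(* Matrix indices start at 0, so the 1-based condition i + j \<le> m + 1 is applied to i + 1 and j + 1. *)
definition Bmat :: "nat \<Rightarrow> nat mat" where
  "Bmat m = mat m m (\<lambda>(i, j). if (i + 1) + (j + 1) \<le> m + 1 then 1 else 0)"

definition entry_sum :: "'a :: comm_monoid_add mat \<Rightarrow> 'a" where
  "entry_sum A = (\<Sum>i<dim_row A. \<Sum>j<dim_col A. A $$ (i, j))"

definition b :: "nat \<Rightarrow> nat \<Rightarrow> nat" where
  "b n m = (if n = 0 \<or> m = 0 then 1 else entry_sum (Bmat (m + 1) ^\<^sub>m (n - 1)))"

definition F :: "nat \<Rightarrow> rat fps" where
  "F m = Abs_fps (\<lambda>n. of_nat (b n m))"

end

theory Submission
  imports Defs
begin

text \<open>
  With \<open>v\<^sub>j\<close> the generating function of the \<open>j\<close>-th column sums of the powers of \<open>B(m + 1)\<close>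
  (indices starting at 0), \<open>v\<^sub>j - v\<^sub>j\<^sub>+\<^sub>1 = x v\<^sub>m\<^sub>-\<^sub>j\<close> for \<open>0 \<le> j \<le> m\<close>, where \<open>v\<^sub>m\<^sub>+\<^sub>1 = 1\<close>, and \<open>v\<^sub>0 = F\<^sub>m\<close>.
  Let \<open>u\<^sub>j\<close> be the corresponding series for \<open>m - 1\<close>, taken at \<open>-x\<close>. Then
  \<open>v\<^sub>j u\<^sub>j - v\<^sub>j\<^sub>+\<^sub>1 u\<^sub>j\<^sub>+\<^sub>1 = x (v\<^sub>m\<^sub>-\<^sub>j u\<^sub>j - v\<^sub>j\<^sub>+\<^sub>1 u\<^sub>m\<^sub>-\<^sub>1\<^sub>-\<^sub>j)\<close>, and the sum of the right-hand side over \<open>0 \<le> j < m\<close>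
  vanishes, as the reflection \<open>j \<mapsto> m - 1 - j\<close> swaps its two terms. Hence
  \<open>v\<^sub>0 u\<^sub>0 = v\<^sub>m u\<^sub>m = v\<^sub>m = 1 + x v\<^sub>0\<close>.
\<close>

text \<open>Column \<open>j\<close> is not confined to \<open>j \<le> m\<close>: at
  \<open>j = Suc m\<close> the sum is empty, so the counts 1, 0, 0, ... supply the boundary series
  1.\<close>

fun col_count :: "nat \<Rightarrow> nat \<Rightarrow> nat \<Rightarrow> nat" where
  "col_count m 0 j = 1"
| "col_count m (Suc n) j = (\<Sum>k | k + j \<le> m. col_count m n k)"

lemma Bmat_pow_carrier: "Bmat m ^\<^sub>m n \<in> carrier_mat m m"
  by (rule pow_carrier_mat) (simp add: Bmat_def)

lemma col_sum_Bmat_pow: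
  assumes "j \<le> m"
  shows "(\<Sum>i\<le>m. (Bmat (Suc m) ^\<^sub>m n) $$ (i, j)) = col_count m n j"
  using assms
proof (induction n arbitrary: j)
  case 0
  then have "(\<Sum>i\<le>m. (Bmat (Suc m) ^\<^sub>m 0) $$ (i, j)) = (\<Sum>i\<le>m. if i = j then 1 else 0)"
    by (intro sum.cong) (auto simp: Bmat_def)
  with 0 show ?case by simp
next
  case (Suc n)
  let ?P = "Bmat (Suc m) ^\<^sub>m n"
  have P: "?P \<in> carrier_mat (Suc m) (Suc m)"
    by (rule Bmat_pow_carrier)
  \<comment> \<open>With indices from 0 and size \<open>Suc m\<close>, the support condition of the
    matrix becomes \<open>k + j \<le> m\<close>.\<close>
  have entry: "(?P * Bmat (Suc m)) $$ (i, j) = (\<Sum>k\<le>m. if k + j \<le> m then ?P $$ (i, k) else 0)"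
    if "i \<le> m" for i
  proof -
    have "(?P * Bmat (Suc m)) $$ (i, j) = (\<Sum>k<Suc m. ?P $$ (i, k) * Bmat (Suc m) $$ (k, j))"
      using P that Suc.prems by (auto simp: Bmat_def scalar_prod_def lessThan_atLeast0)
    also have "\<dots> = (\<Sum>k\<le>m. if k + j \<le> m then ?P $$ (i, k) else 0)"
      using Suc.prems unfolding lessThan_Suc_atMost by (intro sum.cong) (auto simp: Bmat_def)
    finally show ?thesis .
  qed
  have "(\<Sum>i\<le>m. (Bmat (Suc m) ^\<^sub>m Suc n) $$ (i, j))
      = (\<Sum>i\<le>m. \<Sum>k\<le>m. if k + j \<le> m then ?P $$ (i, k) else 0)"
    by (simp add: entry)
  also have "\<dots> = (\<Sum>k\<le>m. \<Sum>i\<le>m. if k + j \<le> m then ?P $$ (i, k) else 0)"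
    by (rule sum.swap)
  also have "\<dots> = (\<Sum>k\<le>m. if k + j \<le> m then col_count m n k else 0)"
    by (intro sum.cong) (auto simp: Suc.IH)
  also have "\<dots> = (\<Sum>k | k + j \<le> m. col_count m n k)"
    by (intro sum.mono_neutral_cong_right) auto
  finally show ?case by simp
qed

text \<open>Column 0 of \<open>Bmat (Suc m)\<close> is all ones, so one more factor collects all
  column sums in column 0. This absorbs the exponent \<open>n - 1\<close> in
  \<open>b\<close>.\<close>

lemma entry_sum_Bmat_pow: "entry_sum (Bmat (Suc m) ^\<^sub>m n) = col_count m (Suc n) 0"
proof -
  have "entry_sum (Bmat (Suc m) ^\<^sub>m n) = (\<Sum>i\<le>m. \<Sum>j\<le>m. (Bmat (Suc m) ^\<^sub>m n) $$ (i, j))"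
    unfolding entry_sum_def carrier_matD[OF Bmat_pow_carrier] lessThan_Suc_atMost ..
  also have "\<dots> = (\<Sum>j\<le>m. \<Sum>i\<le>m. (Bmat (Suc m) ^\<^sub>m n) $$ (i, j))"
    by (rule sum.swap)
  also have "\<dots> = (\<Sum>j\<le>m. col_count m n j)"
    by (simp add: col_sum_Bmat_pow)
  finally show ?thesis by (simp add: atMost_def)
qed

lemma b_eq_col_count: "b n m = col_count m n 0"
proof (cases "m = 0")
  case True
  have "col_count 0 n 0 = 1" by (induction n) simp_all
  with True show ?thesis by (simp add: b_def)
next
  case False
  then show ?thesis
    by (cases n) (simp_all add: b_def entry_sum_Bmat_pow del: col_count.simps(2))
qed

definition col_fps :: "nat \<Rightarrow> nat \<Rightarrow> rat fps" where
  "col_fps m j = Abs_fps (\<lambda>n. of_nat (col_count m n j))"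

lemma F_eq_col_fps: "F m = col_fps m 0"
  by (simp add: F_def col_fps_def b_eq_col_count)

lemma col_fps_rec: "col_fps m j = 1 + fps_X * (\<Sum>k | k + j \<le> m. col_fps m k)"
proof (rule fps_ext)
  fix n
  show "fps_nth (col_fps m j) n = fps_nth (1 + fps_X * (\<Sum>k | k + j \<le> m. col_fps m k)) n"
    by (cases n) (simp_all add: col_fps_def fps_sum_nth)
qed

lemma col_fps_Suc_self: "col_fps m (Suc m) = 1"
  by (subst col_fps_rec) simp

lemma col_fps_diff:
  assumes "j \<le> m"
  shows "col_fps m j - col_fps m (Suc j) = fps_X * col_fps m (m - j)"
proof -
  \<comment> \<open>Passing from \<open>j\<close> to \<open>Suc j\<close> removes only
    \<open>k = m - j\<close> from the range of summation.\<close>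
  have "{k. k + j \<le> m} = insert (m - j) {k. k + Suc j \<le> m}" "finite {k. k + Suc j \<le> m}"
    using assms by (auto intro: finite_subset[of _ "{..m}"])
  moreover have "m - j \<notin> {k. k + Suc j \<le> m}" by auto
  ultimately have "(\<Sum>k | k + j \<le> m. col_fps m k)
      = col_fps m (m - j) + (\<Sum>k | k + Suc j \<le> m. col_fps m k)"
    by (metis sum.insert)
  then show ?thesis
    by (subst (1 2) col_fps_rec) (simp add: algebra_simps)
qed

lemma col_fps_last: "col_fps m m = 1 + fps_X * col_fps m 0"
  using col_fps_diff[of m m] by (simp add: col_fps_Suc_self algebra_simps)

lemma reflected_telescoping:
  fixes u v :: "nat \<Rightarrow> 'a :: comm_ring_1"
  assumes v: "\<And>j. j < m \<Longrightarrow> v j - v (Suc j) = x * v (m - j)"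
    and u: "\<And>j. j < m \<Longrightarrow> u j - u (Suc j) = - x * u (m - Suc j)"
  shows "v 0 * u 0 = v m * u m"
proof -
  have "v 0 * u 0 - v m * u m = (\<Sum>j<m. v j * u j - v (Suc j) * u (Suc j))"
    by (rule sum_lessThan_telescope'[of "\<lambda>j. v j * u j", symmetric])
  also have "\<dots> = (\<Sum>j<m. x * v (m - j) * u j - x * v (Suc j) * u (m - Suc j))"
  proof (rule sum.cong)
    fix j assume "j \<in> {..<m}"
    then have j: "j < m" by simp
    \<comment> \<open>A discrete product rule, so that each recurrence can be applied to its own
      difference.\<close>
    have "v j * u j - v (Suc j) * u (Suc j) = (v j - v (Suc j)) * u j + v (Suc j) * (u j - u (Suc j))"
      by (simp add: algebra_simps)
    then show "v j * u j - v (Suc j) * u (Suc j) = x * v (m - j) * u j - x * v (Suc j) * u (m - Suc j)"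
      unfolding v[OF j] u[OF j] by (simp add: algebra_simps)
  qed simp
  also have "\<dots> = (\<Sum>j<m. x * v (m - j) * u j) - (\<Sum>j<m. x * v (Suc j) * u (m - Suc j))"
    by (rule sum_subtractf)
  also have "(\<Sum>j<m. x * v (Suc j) * u (m - Suc j)) = (\<Sum>j<m. x * v (m - j) * u j)"
    by (subst sum.nat_diff_reindex[symmetric]) (auto intro!: sum.cong simp: Suc_diff_Suc)
  finally show ?thesis by simp
qed

lemma F_mult_compose:
  "F (Suc m) * (- fps_X + (F m oo (- fps_X))) = 1"
proof -
  let ?u = "\<lambda>j. col_fps m j oo (- fps_X)"
  have "col_fps (Suc m) 0 * ?u 0 = col_fps (Suc m) (Suc m) * ?u (Suc m)"
  proof (rule reflected_telescoping)
    fix j assume "j < Suc m"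
    then show "col_fps (Suc m) j - col_fps (Suc m) (Suc j) = fps_X * col_fps (Suc m) (Suc m - j)"
      by (intro col_fps_diff) simp
    have "?u j - ?u (Suc j) = (col_fps m j - col_fps m (Suc j)) oo (- fps_X)"
      by (simp add: fps_compose_sub_distrib)
    \<comment> \<open>Substituting \<open>- fps_X\<close> flips the sign of the recurrence, which
      makes the two cross terms cancel after reflection.\<close>
    also have "\<dots> = - fps_X * ?u (Suc m - Suc j)"
      using \<open>j < Suc m\<close> by (simp add: col_fps_diff fps_compose_mult_distrib)
    finally show "?u j - ?u (Suc j) = - fps_X * ?u (Suc m - Suc j)" .
  qed
  then show ?thesis
    by (simp add: F_eq_col_fps col_fps_last col_fps_Suc_self algebra_simps)
qed

lemma fps_eq_one_divide:
  fixes f g :: "'a :: field fps"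
  assumes "f * g = 1"
  shows "f = 1 / g"
proof -
  have "g \<noteq> 0" using assms by auto
  then have "f * g div g = f" by simp
  with assms show ?thesis by simp
qed

theorem theorem7:
  shows "F 0 = 1 / (1 - fps_X) \<and>
    (\<forall>m\<ge>1. F m = 1 / (- fps_X + fps_compose (F (m - 1)) (- fps_X)))"
proof (intro conjI allI impI)
  have "F 0 * (1 - fps_X) = 1"
    \<comment> \<open>For \<open>m = 0\<close> the last column is also the first, so the boundary
      relation reads \<open>F 0 = 1 + fps_X * F 0\<close>.\<close>
    using col_fps_last[of 0] by (simp add: F_eq_col_fps algebra_simps)
  then show "F 0 = 1 / (1 - fps_X)"
    by (rule fps_eq_one_divide)
next
  fix m :: nat
  assume "1 \<le> m"
  then show "F m = 1 / (- fps_X + fps_compose (F (m - 1)) (- fps_X))"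
    using F_mult_compose[of "m - 1"] by (intro fps_eq_one_divide) simp
qed

end
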